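(* Assume $2K\le N_R$ and $\dim_{\mathbb{C}}\mathcal{S}_K^\star(\boldsymbol{\theta})=2K$, where $\mathcal{S}_K^\star(\boldsymbol{\theta}):=\operatorname{span}_{\mathbb{C}}\{\mathbf{a}(\theta_k),\dot{\mathbf{a}}(\theta_k)\}_{k=1}^K\subseteq\mathbb{C}^{N_R}$. For every $L_R\ge 2K$ (with $L_R\le N_R$) and every full-row-rank $\mathbf{G}\in\mathcal{F}_{\mathrm{MiLAC}}\subseteq\mathbb{C}^{L_R\times N_R}$ with $\operatorname{row}(\mathbf{G})\supseteq\mathcal{S}_K^\star(\boldsymbol{\theta})$, $$\mathbf{J}_{\mathrm{MiLAC}}(\boldsymbol{\xi};\mathbf{G})=\mathbf{J}_{\mathrm{dig}}(\boldsymbol{\xi}),\qquad \mathrm{CRB}_{\mathrm{MiLAC}}(\boldsymbol{\theta};\mathbf{G})=\mathrm{CRB}_{\mathrm{dig}}(\boldsymbol{\theta}).$$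
   Context: $K,T\ge1$. $\mathbf{a}:\mathbb{R}\to\mathbb{C}^{N_R}$ is a differentiable steering-vector function with derivative $\dot{\mathbf{a}}$; $\theta_1,\dots,\theta_K\in\mathbb{R}$ are distinct, $\boldsymbol\theta=[\theta_1,\dots,\theta_K]^{\mathsf T}$; $\beta_1,\dots,\beta_K\in\mathbb{C}\setminus\{0\}$; $\mathbf{s}=(s_1,\dots,s_T)\in\mathbb{C}^T$ is a known nonzero waveform; $\sigma^2>0$. The real parameter vector is $\boldsymbol{\xi}=[\theta_1,\dots,\theta_K,\Re\beta_1,\Im\beta_1,\dots,\Re\beta_K,\Im\beta_K]^{\mathsf T}\in\mathbb{R}^{3K}$. Let $\boldsymbol{\mu}_t=s_t\sum_{k}\beta_k\mathbf{a}(\theta_k)$, so $\partial_{\theta_k}\boldsymbol{\mu}_t=s_t\beta_k\dot{\mathbf{a}}(\theta_k)$, $\partial_{\Re\beta_k}\boldsymbol{\mu}_t=s_t\mathbf{a}(\theta_k)$, $\partial_{\Im\beta_k}\boldsymbol{\mu}_t=js_t\mathbf{a}(\theta_k)$. Let $\mathcal{J}_{\mathrm{dig}}\in\mathbb{C}^{TN_R\times3K}$ be the vertical stack over $t$ of $\partial\boldsymbol{\mu}_t/\partial\boldsymbol{\xi}$. Define $\mathbf{J}_{\mathrm{dig}}(\boldsymbol{\xi})=\frac{2}{\sigma^2}\Re\{\mathcal{J}_{\mathrm{dig}}^{\mathsf H}\mathcal{J}_{\mathrm{dig}}\}$ and, for full-row-rank $\mathbf{G}\in\mathbb{C}^{L_R\times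 N_R}$, $$\mathbf{J}_{\mathrm{MiLAC}}(\boldsymbol{\xi};\mathbf{G})=\frac{2}{\sigma^2}\Re\bigl\{\mathcal{J}_{\mathrm{dig}}^{\mathsf H}\bigl(\mathbf{I}_T\otimes\mathbf{G}^{\mathsf H}(\mathbf{G}\mathbf{G}^{\mathsf H})^{-1}\mathbf{G}\bigr)\mathcal{J}_{\mathrm{dig}}\bigr\}.$$ These are the Fisher information matrices about $\boldsymbol{\xi}$ in the observations $\boldsymbol{\mu}_t+\mathbf{n}_t$ and $\mathbf{G}(\boldsymbol{\mu}_t+\mathbf{n}_t)$ respectively, with $\mathbf{n}_t\sim\mathcal{CN}(\mathbf{0},\sigma^2\mathbf{I}_{N_R})$ independent over $t$. For a $3K\times3K$ information matrix $\mathbf{J}$ partitioned into angle block $\mathbf{J}_{\theta\theta}$ ($K\times K$), amplitude block $\mathbf{J}_{\beta\beta}$ ($2K\times2K$) and cross blocks, $\mathrm{CRB}(\boldsymbol{\theta})=(\mathbf{J}_{\theta\theta}-\mathbf{J}_{\theta\beta}\mathbf{J}_{\beta\beta}^{-1}\mathbf{J}_{\beta\theta})^{-1}$. $\mathcal{F}_{\mathrm{MiLAC}}$ is the set of $\mathbf{G}\in\mathbb{C}^{L_R\times N_R}$ that occur as the lower-left block $\boldsymbol{\Theta}_{21}$ of some $\boldsymbol{\Theta}=\begin{bmatrix}\boldsymbol{\Theta}_{11}&\boldsymbol{\Theta}_{12}\\ \boldsymbol{\Theta}_{21}&\boldsymbol{\Theta}_{22}\end{bmatrix}\in\mathbb{C}^{(N_R+L_R)\times(N_R+L_R)}$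 (with $\boldsymbol{\Theta}_{11}$ of size $N_R\times N_R$) that is symmetric unitary: $\boldsymbol{\Theta}^{\mathsf H}\boldsymbol{\Theta}=\mathbf{I}$, $\boldsymbol{\Theta}^{\mathsf T}=\boldsymbol{\Theta}$. Convention: $\operatorname{row}(\mathbf{G}):=\operatorname{col}(\mathbf{G}^{\mathsf H})$. *)

theory Defs
  imports "HOL-Analysis.Analysis"
begin

text \<open>
  The sizes \<open>N\<^sub>R\<close>, \<open>L\<^sub>R\<close>, \<open>K\<close>, \<open>T\<close> are the cardinalities of the finite index types
  \<open>'n\<close>, \<open>'l\<close>, \<open>'k\<close>, \<open>'t\<close>. Block and stacked indices are sums and products of these types:
  \<open>'n + 'l\<close> for a square matrix of size \<open>N\<^sub>R + L\<^sub>R\<close>, and \<open>'t \<times> 'n\<close> for a stack over snapshots.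
\<close>

definition conj_transpose :: "complex ^ 'n ^ 'm \<Rightarrow> complex ^ 'm ^ 'n"
  where "conj_transpose A = map_matrix cnj (transpose A)"

definition kronecker ::
  "complex ^ 'b ^ 'a \<Rightarrow> complex ^ 'd ^ 'c \<Rightarrow> complex ^ ('b \<times> 'd) ^ ('a \<times> 'c)"
  where "kronecker A B = (\<chi> i j. A $ fst i $ fst j * B $ snd i $ snd j)"

definition row_space :: "complex ^ 'n ^ 'm \<Rightarrow> (complex ^ 'n) set"
  where "row_space G = vec.span (columns (conj_transpose G))"

text \<open>
  Parameter indices: \<open>Inl k\<close> is the \<open>k\<close>-th angle, \<open>Inr (k, False)\<close> and \<open>Inr (k, True)\<close> are the
  real and the imaginary part of the \<open>k\<close>-th amplitude.
\<close>

type_synonym 'k param = "'k + 'k \<times> bool"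

definition param_vec :: "real ^ 'k::finite \<Rightarrow> complex ^ 'k \<Rightarrow> real ^ 'k param"
  where "param_vec \<theta> \<beta> = (\<chi> p. case p of
      Inl k \<Rightarrow> \<theta> $ k
    | Inr (k, im) \<Rightarrow> (if im then Im (\<beta> $ k) else Re (\<beta> $ k)))"

definition mean_obs ::
  "(real \<Rightarrow> complex ^ 'n) \<Rightarrow> complex ^ 't \<Rightarrow> real ^ 'k::finite param \<Rightarrow> 't \<Rightarrow> complex ^ 'n"
  where "mean_obs a s \<xi> t =
    s $ t *s (\<Sum>k\<in>UNIV. Complex (\<xi> $ Inr (k, False)) (\<xi> $ Inr (k, True)) *s a (\<xi> $ Inl k))"

definition partial_deriv :: "(real ^ 'p \<Rightarrow> 'v::real_normed_vector) \<Rightarrow> 'p \<Rightarrow> real ^ 'p \<Rightarrow> 'v"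
  where "partial_deriv f p \<xi> = vector_derivative (\<lambda>h. f (\<xi> + h *\<^sub>R axis p 1)) (at 0)"

definition jac_dig ::
  "(real \<Rightarrow> complex ^ 'n) \<Rightarrow> complex ^ 't \<Rightarrow> real ^ 'k::finite param \<Rightarrow> complex ^ 'k param ^ ('t \<times> 'n)"
  where "jac_dig a s \<xi> =
    (\<chi> r p. partial_deriv (\<lambda>\<xi>. mean_obs a s \<xi> (fst r)) p \<xi> $ snd r)"

definition fim_dig ::
  "(real \<Rightarrow> complex ^ 'n) \<Rightarrow> complex ^ 't \<Rightarrow> real \<Rightarrow> real ^ 'k::finite param
    \<Rightarrow> real ^ 'k param ^ 'k param"
  where "fim_dig a s sigma_sq \<xi> =
    (2 / sigma_sq) *\<^sub>R map_matrix Re (conj_transpose (jac_dig a s \<xi>) ** jac_dig a s \<xi>)"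

definition fim_milac ::
  "(real \<Rightarrow> complex ^ 'n) \<Rightarrow> complex ^ 't \<Rightarrow> real \<Rightarrow> real ^ 'k::finite param \<Rightarrow> complex ^ 'n ^ 'l
    \<Rightarrow> real ^ 'k param ^ 'k param"
  where "fim_milac a s sigma_sq \<xi> G =
    (2 / sigma_sq) *\<^sub>R map_matrix Re
      (conj_transpose (jac_dig a s \<xi>)
        ** kronecker (mat 1) (conj_transpose G ** matrix_inv (G ** conj_transpose G) ** G)
        ** jac_dig a s \<xi>)"

definition block11 :: "'a ^ ('k::finite + 'b::finite) ^ ('k + 'b) \<Rightarrow> 'a ^ 'k ^ 'k"
  where "block11 J = (\<chi> i j. J $ Inl i $ Inl j)"

definition block12 :: "'a ^ ('k::finite + 'b::finite) ^ ('k + 'b) \<Rightarrow> 'a ^ 'b ^ 'k"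
  where "block12 J = (\<chi> i j. J $ Inl i $ Inr j)"

definition block21 :: "'a ^ ('k::finite + 'b::finite) ^ ('k + 'b) \<Rightarrow> 'a ^ 'k ^ 'b"
  where "block21 J = (\<chi> i j. J $ Inr i $ Inl j)"

definition block22 :: "'a ^ ('k::finite + 'b::finite) ^ ('k + 'b) \<Rightarrow> 'a ^ 'b ^ 'b"
  where "block22 J = (\<chi> i j. J $ Inr i $ Inr j)"

definition schur_complement :: "real ^ ('k::finite + 'b::finite) ^ ('k + 'b) \<Rightarrow> real ^ 'k ^ 'k"
  where "schur_complement J =
    block11 J - block12 J ** matrix_inv (block22 J) ** block21 J"

definition crb :: "real ^ ('k::finite + 'b::finite) ^ ('k + 'b) \<Rightarrow> real ^ 'k ^ 'k"
  where "crb J = matrix_inv (schur_complement J)"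

definition feasible_milac :: "(complex ^ 'n ^ 'l) set"
  where "feasible_milac =
    {block21 \<Theta> | \<Theta> :: complex ^ ('n::finite + 'l::finite) ^ ('n + 'l).
       conj_transpose \<Theta> ** \<Theta> = mat 1 \<and> transpose \<Theta> = \<Theta>}"

definition steering_span ::
  "(real \<Rightarrow> complex ^ 'n) \<Rightarrow> (real \<Rightarrow> complex ^ 'n) \<Rightarrow> real ^ 'k \<Rightarrow> (complex ^ 'n) set"
  where "steering_span a a' \<theta> =
    vec.span (range (\<lambda>k. a (\<theta> $ k)) \<union> range (\<lambda>k. a' (\<theta> $ k)))"

lemma partial_deriv_mean_obs:
  assumes "\<And>x. (a has_vector_derivative a' x) (at x)"
  shows "partial_deriv (\<lambda>\<xi>. mean_obs a s \<xi> t) p (param_vec \<theta> \<beta>) =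
    (case p of
      Inl k \<Rightarrow> (s $ t * \<beta> $ k) *s a' (\<theta> $ k)
    | Inr (k, im) \<Rightarrow> ((if im then \<i> else 1) * s $ t) *s a (\<theta> $ k))"
proof -
  have scale: "bounded_linear (\<lambda>x. c *s x)" for c :: complex and x :: "complex ^ 'n"
    by (rule linear_conv_bounded_linear[THEN iffD1], rule linearI)
       (simp_all add: vec_eq_iff algebra_simps)
  have a_at: "((\<lambda>h. a (x + h)) has_vector_derivative a' x) (at 0)" for x
    using assms[of x] by (simp add: has_vector_derivative_def has_derivative_at fun_eq_iff) 
  define c where "c j = (case p of
      Inl k \<Rightarrow> if j = k then \<beta> $ k *s a' (\<theta> $ k) else 0
    | Inr (k, im) \<Rightarrow> if j = k then (if im then \<i> else 1) *s a (\<theta> $ k) else 0)" for j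
  have summand: "((\<lambda>h. let \<xi> = param_vec \<theta> \<beta> + h *\<^sub>R axis p 1 in
      Complex (\<xi> $ Inr (j, False)) (\<xi> $ Inr (j, True)) *s a (\<xi> $ Inl j))
      has_vector_derivative c j) (at 0)" for j
  proof (cases p)
    case (Inl k)
    show ?thesis
    proof (cases "j = k")
      case True
      have "((\<lambda>h. \<beta> $ k *s a (\<theta> $ k + h)) has_vector_derivative \<beta> $ k *s a' (\<theta> $ k)) (at 0)"
        by (rule bounded_linear.has_vector_derivative[OF scale a_at])
      then show ?thesis
        by (simp add: Inl True c_def param_vec_def axis_def)
    next
      case False
      then show ?thesis by (simp add: Inl c_def param_vec_def axis_def)
    qed
  next
    case (Inr q)
    obtain k im where q: "q = (k, im)" by force
    show ?thesis
    proof (cases "j = k")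
      case True
      let ?e = "if im then \<i> else 1"
      have "((\<lambda>h. \<beta> $ k *s a (\<theta> $ k) + h *\<^sub>R (?e *s a (\<theta> $ k)))
          has_vector_derivative ?e *s a (\<theta> $ k)) (at 0)"
        by (auto intro!: derivative_eq_intros simp: has_vector_derivative_def)
      moreover have "(let \<xi> = param_vec \<theta> \<beta> + h *\<^sub>R axis p 1 in
          Complex (\<xi> $ Inr (j, False)) (\<xi> $ Inr (j, True)) *s a (\<xi> $ Inl j)) =
          \<beta> $ k *s a (\<theta> $ k) + h *\<^sub>R (?e *s a (\<theta> $ k))" for h
        by (simp add: Inr q True param_vec_def axis_def vec_eq_iff complex_eq_iff algebra_simps)
      ultimately show ?thesis by (simp add: Inr q True c_def)
    next
      case False
      then show ?thesis by (simp add: Inr q c_def param_vec_def axis_def)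
    qed
  qed
  have "((\<lambda>h. mean_obs a s (param_vec \<theta> \<beta> + h *\<^sub>R axis p 1) t)
      has_vector_derivative s $ t *s (\<Sum>j\<in>UNIV. c j)) (at 0)"
    unfolding mean_obs_def
    by (rule bounded_linear.has_vector_derivative[OF scale], rule has_vector_derivative_sum)
       (use summand in \<open>simp add: Let_def\<close>)
  then have "partial_deriv (\<lambda>\<xi>. mean_obs a s \<xi> t) p (param_vec \<theta> \<beta>) =
      s $ t *s (\<Sum>j\<in>UNIV. c j)"
    unfolding partial_deriv_def by (rule vector_derivative_at)
  then show ?thesis
    by (simp add: c_def mult.commute split: sum.split prod.split)
qed

lemma invertible_of_kernel:
  fixes A :: "real ^ 'p ^ 'p"
  assumes "\<And>x. A *v x = 0 \<Longrightarrow> x = 0"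
  shows "invertible A"
  using assms by (simp add: invertible_left_inverse matrix_left_invertible_ker)

lemma sum_UNIV_Plus:
  fixes f :: "'k::finite + 'b::finite \<Rightarrow> 'c::comm_monoid_add"
  shows "sum f UNIV = (\<Sum>i\<in>UNIV. f (Inl i)) + (\<Sum>i\<in>UNIV. f (Inr i))"
  by (simp flip: UNIV_Plus_UNIV add: sum.Plus)

lemma schur_well_defined:
  fixes J :: "real ^ ('k::finite + 'b::finite) ^ ('k + 'b)"
  assumes pos: "\<And>x. inner x (J *v x) = 0 \<Longrightarrow> x = 0"
  shows "invertible (block22 J)" and "invertible (schur_complement J)"
proof -
  define join where "join u w = (\<chi> p. case p of Inl i \<Rightarrow> u $ i | Inr j \<Rightarrow> w $ j)"
    for u :: "real ^ 'k" and w :: "real ^ 'b"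
  have mult: "J *v join u w =
      join (block11 J *v u + block12 J *v w) (block21 J *v u + block22 J *v w)" for u w
    by (simp add: vec_eq_iff matrix_vector_mult_def join_def sum_UNIV_Plus
        block11_def block12_def block21_def block22_def split: sum.split)
  have inner_join: "inner (join u w) (join u' w') = inner u u' + inner w w'" for u w u' w'
    by (simp add: inner_vec_def join_def sum_UNIV_Plus)
  have join_0: "u = 0 \<and> w = 0" if "join u w = 0" for u w
    using that by (auto simp: vec_eq_iff join_def dest: spec[of _ "Inl _"] spec[of _ "Inr _"])
  show inv: "invertible (block22 J)"
  proof (rule invertible_of_kernel)
    fix w assume "block22 J *v w = 0"
    then show "w = 0"
      using join_0[OF pos[of "join 0 w"]] by (simp add: mult inner_join)
  qed
  show "invertible (schur_complement J)"
  proof (rule invertible_of_kernel)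
    fix u assume u: "schur_complement J *v u = 0"
    define w where "w = - (matrix_inv (block22 J) *v (block21 J *v u))"
    have "block22 J ** matrix_inv (block22 J) = mat 1"
      using inv unfolding invertible_def matrix_inv_def by (metis (mono_tags, lifting) someI_ex)
    then have "block22 J *v w = - (block21 J *v u)"
      by (simp add: w_def matrix_vector_mul_assoc matrix_mul_assoc vec.neg)
    moreover have "block11 J *v u + block12 J *v w = 0"
      using u by (simp add: w_def schur_complement_def matrix_vector_mult_diff_rdistrib
          matrix_vector_mul_assoc matrix_mul_assoc vec.neg)
    ultimately show "u = 0"
      using join_0[OF pos[of "join u w"]] by (simp add: mult inner_join)
  qed
qed

lemma inner_gram:
  fixes M :: "complex ^ 'p ^ 'r" and x :: "real ^ 'p"
  shows "inner x (map_matrix Re (conj_transpose M ** M) *v x) =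
    (\<Sum>r\<in>UNIV. (cmod (\<Sum>p\<in>UNIV. M $ r $ p * of_real (x $ p)))\<^sup>2)"
proof -
  define g where "g r p q = Re (cnj (M $ r $ p) * M $ r $ q)" for r p q
  have "(cmod (\<Sum>p\<in>UNIV. M $ r $ p * of_real (x $ p)))\<^sup>2 =
      (\<Sum>p\<in>UNIV. \<Sum>q\<in>UNIV. x $ p * (g r p q * x $ q))" for r
  proof -
    let ?z = "\<Sum>p\<in>UNIV. M $ r $ p * of_real (x $ p)"
    have prod: "Re (cnj (u * of_real b) * (v * of_real c)) = b * (Re (cnj u * v) * c)" for u v b c
      by (simp add: algebra_simps)
    have norm: "(cmod z)\<^sup>2 = Re (cnj z * z)" for z
      using cmod_power2[of z] by (simp add: power2_eq_square)
    have "(cmod ?z)\<^sup>2 = Re (cnj ?z * ?z)" by (rule norm)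
    also have "\<dots> = (\<Sum>p\<in>UNIV. \<Sum>q\<in>UNIV. x $ p * (g r p q * x $ q))"
      unfolding cnj_sum sum_product Re_sum g_def prod ..
    finally show ?thesis .
  qed
  then have "(\<Sum>r\<in>UNIV. (cmod (\<Sum>p\<in>UNIV. M $ r $ p * of_real (x $ p)))\<^sup>2) =
      (\<Sum>r\<in>UNIV. \<Sum>p\<in>UNIV. \<Sum>q\<in>UNIV. x $ p * (g r p q * x $ q))"
    by (simp only:)
  also have "\<dots> = (\<Sum>p\<in>UNIV. \<Sum>r\<in>UNIV. \<Sum>q\<in>UNIV. x $ p * (g r p q * x $ q))"
    by (rule sum.swap)
  also have "\<dots> = (\<Sum>p\<in>UNIV. \<Sum>q\<in>UNIV. \<Sum>r\<in>UNIV. x $ p * (g r p q * x $ q))"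
    by (rule sum.cong[OF refl], rule sum.swap)
  also have "\<dots> = (\<Sum>p\<in>UNIV. x $ p * (\<Sum>q\<in>UNIV. (\<Sum>r\<in>UNIV. g r p q) * x $ q))"
    by (simp only: sum_distrib_left sum_distrib_right)
  also have "\<dots> = inner x (map_matrix Re (conj_transpose M ** M) *v x)"
    by (simp add: inner_vec_def matrix_vector_mult_def matrix_matrix_mult_def conj_transpose_def
        transpose_def g_def)
  finally show ?thesis by (rule sym)
qed

lemma steering_independent:
  fixes \<theta> :: "real ^ 'k" and a a' :: "real \<Rightarrow> complex ^ 'n"
  assumes dim: "vec.dim (steering_span a a' \<theta>) = 2 * CARD('k)"
    and sum0: "(\<Sum>k\<in>UNIV. c k *s a (\<theta> $ k) + d k *s a' (\<theta> $ k)) = 0"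
  shows "c k = 0 \<and> d k = 0"
proof -
  define v where "v = (\<lambda>i::'k + 'k. case i of Inl k \<Rightarrow> a (\<theta> $ k) | Inr k \<Rightarrow> a' (\<theta> $ k))"
  define e where "e = (\<lambda>i::'k + 'k. case i of Inl k \<Rightarrow> c k | Inr k \<Rightarrow> d k)"
  have range_v: "range v = range (\<lambda>k. a (\<theta> $ k)) \<union> range (\<lambda>k. a' (\<theta> $ k))"
    by (simp add: UNIV_sum v_def image_Un image_image)
  have dim': "vec.dim (range v) = CARD('k + 'k)"
    using dim by (simp add: steering_span_def range_v)
  have "vec.dim (range v) \<le> card (range v)"
    by (rule vec.dim_le_card) (auto intro: vec.span_base)
  then have card: "card (range v) = CARD('k + 'k)"
    using dim' card_image_le[of UNIV v] by simp
  then have inj: "inj v" by (intro eq_card_imp_inj_on) simp_all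
  have indep: "vec.independent (range v)"
    by (rule vec.card_le_dim_spanning[of _ "range v"]) (auto simp: card dim' vec.span_base)
  have "(\<Sum>x\<in>range v. e (inv v x) *s x) = (\<Sum>i\<in>UNIV. e i *s v i)"
    using inj by (simp add: sum.reindex)
  also have "\<dots> = 0"
    using sum0 by (simp add: sum_UNIV_Plus e_def v_def sum.distrib)
  finally have "e (inv v (v i)) = 0" for i
    by (intro vec.independentD[OF indep, of "range v" "\<lambda>x. e (inv v x)"]) simp_all
  then have "e i = 0" for i using inj by simp
  from this[of "Inl k"] this[of "Inr k"] show ?thesis by (simp add: e_def)
qed

text \<open>
  Both inverses in \<^const>\<open>crb\<close> exist under these hypotheses, so the arbitrary value of
  \<^const>\<open>matrix_inv\<close> at a singular matrix is not involved.
\<close>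

lemma crb_dig_well_defined:
  fixes \<theta> :: "real ^ 'k" and a a' :: "real \<Rightarrow> complex ^ 'n" and s :: "complex ^ 't"
  assumes deriv: "\<And>x. (a has_vector_derivative a' x) (at x)"
    and \<beta>: "\<And>k. \<beta> $ k \<noteq> 0" and s: "s \<noteq> 0" and sigma_sq: "sigma_sq > 0"
    and dim: "vec.dim (steering_span a a' \<theta>) = 2 * CARD('k)"
  defines "J \<equiv> fim_dig a s sigma_sq (param_vec \<theta> \<beta>)"
  shows "invertible (block22 J)" and "invertible (schur_complement J)"
proof -
  have pos: "x = 0" if "inner x (J *v x) = 0" for x
  proof -
    let ?M = "jac_dig a s (param_vec \<theta> \<beta>)"
    obtain t where t: "s $ t \<noteq> 0" using s by (auto simp: vec_eq_iff)
    have "(\<Sum>r\<in>UNIV. (cmod (\<Sum>p\<in>UNIV. ?M $ r $ p * of_real (x $ p)))\<^sup>2) = 0"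
      using that sigma_sq by (simp add: J_def fim_dig_def scaleR_matrix_vector_assoc[symmetric] inner_gram)
    then have M0: "(\<Sum>p\<in>UNIV. ?M $ r $ p * of_real (x $ p)) = 0" for r
      by (cases r) (simp add: sum_nonneg_eq_0_iff)
    define c where "c k = Complex (x $ Inr (k, False)) (x $ Inr (k, True))" for k
    define d where "d k = \<beta> $ k * of_real (x $ Inl k)" for k
    have pair: "(\<Sum>q\<in>UNIV. f q) = (\<Sum>k\<in>UNIV. f (k, False) + f (k, True))"
      for f :: "'k \<times> bool \<Rightarrow> complex"
      by (simp flip: UNIV_Times_UNIV add: sum.cartesian_product' UNIV_bool add.commute)
    have "s $ t * (\<Sum>k\<in>UNIV. c k *s a (\<theta> $ k) + d k *s a' (\<theta> $ k)) $ n = 0" for n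
    proof -
      have cx: "c k = of_real (x $ Inr (k, False)) + \<i> * of_real (x $ Inr (k, True))" for k
        by (simp add: c_def complex_eq_iff)
      have "s $ t * (\<Sum>k\<in>UNIV. c k *s a (\<theta> $ k) + d k *s a' (\<theta> $ k)) $ n =
          (\<Sum>p\<in>UNIV. ?M $ (t, n) $ p * of_real (x $ p))"
        by (simp add: jac_dig_def partial_deriv_mean_obs[OF deriv] sum_UNIV_Plus pair cx d_def
            sum_distrib_left sum.distrib algebra_simps)
      then show ?thesis using M0 by simp
    qed
    then have "(\<Sum>k\<in>UNIV. c k *s a (\<theta> $ k) + d k *s a' (\<theta> $ k)) = 0"
      using t by (simp add: vec_eq_iff)
    from steering_independent[OF dim this]
    have "c k = 0" "d k = 0" for k by auto
    then have "x $ Inl k = 0" "x $ Inr (k, im) = 0" for k im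
      using \<beta> by (cases im; auto simp: c_def d_def complex_eq_iff)+
    then have "x $ p = 0" for p by (cases p) auto
    then show "x = 0" by (simp add: vec_eq_iff)
  qed
  show "invertible (block22 J)"
    by (rule schur_well_defined(1)[OF pos])
  show "invertible (schur_complement J)"
    by (rule schur_well_defined(2)[OF pos])
qed

end

theory Submission
  imports Defs
begin

text \<open>
  The matrix \<open>P = G\<^sup>H (G G\<^sup>H)\<^sup>-\<^sup>1 G\<close> is the orthogonal projector onto the row space of \<open>G\<close>. Every
  column of the Jacobian, restricted to one snapshot, is a multiple of some steering vector or
  derivative of one, hence lies in that row space, so \<open>I \<otimes> P\<close> fixes the Jacobian.
\<close>

text \<open>\<open>CARD('l)\<close> vectors that span a space of dimension \<open>CARD('l)\<close>
  must be linearly independent, and independence of the rows is equivalent to right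
  invertibility.\<close>

lemma right_invertible_of_full_row_rank:
  fixes G :: "'a::field ^ 'n ^ 'l"
  assumes "rank G = CARD('l)"
  shows "\<exists>B. G ** B = mat 1"
proof -
  have rows: "rows G = range (\<lambda>i. row i G)"
    by (auto simp: rows_def)
  have dim: "vec.dim (range (\<lambda>i. row i G)) = CARD('l)"
    using assms by (simp add: row_rank_def_gen rows)
  \<comment> \<open>The rows enter as a set, so repeated rows must be excluded first: a repetition
    would leave fewer spanning vectors than the dimension.\<close>
  have "vec.dim (range (\<lambda>i. row i G)) \<le> card (range (\<lambda>i. row i G))"
    by (rule vec.dim_le_card) (auto intro: vec.span_base)
  then have card: "card (range (\<lambda>i. row i G)) = CARD('l)"
    using dim card_image_le[of UNIV "\<lambda>i. row i G"] by simp
  then have inj: "inj (\<lambda>i. row i G)"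
    by (intro eq_card_imp_inj_on) simp_all
  have indep: "vec.independent (range (\<lambda>i. row i G))"
    by (rule vec.card_le_dim_spanning[of _ "range (\<lambda>i. row i G)"])
       (auto simp: card dim vec.span_base)
  have "c i = 0" if "(\<Sum>i\<in>UNIV. c i *s row i G) = 0" for c i
  proof -
    let ?c = "\<lambda>x. c (inv (\<lambda>i. row i G) x)"
    have "(\<Sum>x\<in>range (\<lambda>i. row i G). ?c x *s x) = 0"
      using that inj by (simp add: sum.reindex inv_f_f[OF inj])
    then have "?c (row i G) = 0"
      by (intro vec.independentD[OF indep, of "range (\<lambda>i. row i G)" ?c]) simp_all
    then show ?thesis by (simp add: inv_f_f[OF inj])
  qed
  then show ?thesis
    by (simp add: matrix_right_invertible_independent_rows)
qed

lemma conj_transpose_mult: "conj_transpose (A ** B) = conj_transpose B ** conj_transpose A"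
  by (simp add: conj_transpose_def transpose_def matrix_matrix_mult_def vec_eq_iff mult.commute)

lemma conj_transpose_mat_1: "conj_transpose (mat 1) = mat 1"
  by (auto simp: conj_transpose_def transpose_def mat_def vec_eq_iff)

lemma conj_transpose_conj_transpose: "conj_transpose (conj_transpose A) = A"
  by (simp add: conj_transpose_def transpose_def vec_eq_iff)

text \<open>Pairing \<open>conj_transpose A *v (A *v y)\<close> with \<open>y\<close> gives the
  squared norm of \<open>A *v y\<close>, which therefore vanishes.\<close>

lemma gram_kernel:
  fixes A :: "complex ^ 'l ^ 'n"
  assumes "conj_transpose A *v (A *v y) = 0"
  shows "A *v y = 0"
proof -
  let ?v = "A *v y"
  have "complex_of_real (\<Sum>n\<in>UNIV. (cmod (?v $ n))\<^sup>2) = (\<Sum>n\<in>UNIV. ?v $ n * cnj (?v $ n))"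
    by (simp only: of_real_sum complex_norm_square)
  also have "\<dots> = (\<Sum>n\<in>UNIV. \<Sum>l\<in>UNIV. ?v $ n * (cnj (A $ n $ l) * cnj (y $ l)))"
    by (simp add: matrix_vector_mult_def[of A y] sum_distrib_left)
  also have "\<dots> = (\<Sum>l\<in>UNIV. \<Sum>n\<in>UNIV. ?v $ n * (cnj (A $ n $ l) * cnj (y $ l)))"
    by (rule sum.swap)
  also have "\<dots> = (\<Sum>l\<in>UNIV. cnj (y $ l) * (conj_transpose A *v ?v) $ l)"
    unfolding matrix_vector_mult_def[of "conj_transpose A"]
    by (simp add: conj_transpose_def transpose_def sum_distrib_left algebra_simps)
  also have "\<dots> = 0" using assms by simp
  finally have "(\<Sum>n\<in>UNIV. (cmod (?v $ n))\<^sup>2) = 0" by (simp only: of_real_eq_0_iff)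
  then show ?thesis by (simp add: sum_nonneg_eq_0_iff vec_eq_iff)
qed

text \<open>The kernel of \<open>G ** conj_transpose G\<close> is that of
  \<open>conj_transpose G\<close>, which is trivial: the conjugate transpose of a right inverse of
  \<open>G\<close> is a left inverse of \<open>conj_transpose G\<close>.\<close>

lemma invertible_gram:
  fixes G :: "complex ^ 'n ^ 'l"
  assumes "rank G = CARD('l)"
  shows "invertible (G ** conj_transpose G)"
proof -
  obtain B where "G ** B = mat 1"
    using right_invertible_of_full_row_rank[OF assms] by blast
  then have left_inv: "conj_transpose B ** conj_transpose G = mat 1"
    by (metis conj_transpose_mult conj_transpose_mat_1)
  have "y = 0" if "(G ** conj_transpose G) *v y = 0" for y
  proof -
    have "conj_transpose G *v y = 0"
      by (rule gram_kernel)
        (use that in \<open>simp add: conj_transpose_conj_transpose matrix_vector_mul_assoc\<close>)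
    then have "(conj_transpose B ** conj_transpose G) *v y = 0"
      by (simp flip: matrix_vector_mul_assoc)
    then show ?thesis by (simp add: left_inv)
  qed
  then show ?thesis
    by (simp add: invertible_left_inverse matrix_left_invertible_ker)
qed

text \<open>Turns membership in a span into an explicit preimage under
  \<open>conj_transpose G\<close>, on which the projector can be computed.\<close>

lemma row_space_eq_range: "row_space G = range ((*v) (conj_transpose G))"
proof
  have "column i (conj_transpose G) \<in> range ((*v) (conj_transpose G))" for i
    by (rule range_eqI[of _ _ "axis i 1"])
       (simp add: vec_eq_iff column_def matrix_vector_mult_def axis_def if_distrib cong: if_cong)
  then have "columns (conj_transpose G) \<subseteq> range ((*v) (conj_transpose G))"
    by (auto simp: columns_def)
  moreover have "vec.subspace (range ((*v) (conj_transpose G)))"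
    by (intro vec.subspace_image vec.subspace_UNIV)
  ultimately show "row_space G \<subseteq> range ((*v) (conj_transpose G))"
    unfolding row_space_def by (rule vec.span_minimal)
  show "range ((*v) (conj_transpose G)) \<subseteq> row_space G"
    unfolding row_space_def by (auto intro: matrix_vector_mult_in_columnspace_gen)
qed

lemma row_space_projector:
  fixes G :: "complex ^ 'n ^ 'l"
  assumes rank: "rank G = CARD('l)" and v: "v \<in> row_space G"
  shows "(conj_transpose G ** matrix_inv (G ** conj_transpose G) ** G) *v v = v"
proof -
  obtain w where w: "v = conj_transpose G *v w"
    using v by (auto simp: row_space_eq_range)
  \<comment> \<open>\<open>matrix_inv\<close> is a choice operator; full row rank makes its value
    here a genuine inverse. Applied to \<open>conj_transpose G *v w\<close>, the projector then
    cancels its middle factors.\<close>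
  have inv: "matrix_inv (G ** conj_transpose G) ** (G ** conj_transpose G) = mat 1"
    using invertible_gram[OF rank] unfolding invertible_def matrix_inv_def
    by (metis (mono_tags, lifting) someI_ex)
  have "(conj_transpose G ** matrix_inv (G ** conj_transpose G) ** G) *v v =
      conj_transpose G *v ((matrix_inv (G ** conj_transpose G) ** (G ** conj_transpose G)) *v w)"
    by (simp only: w matrix_vector_mul_assoc matrix_mul_assoc)
  then show ?thesis by (simp add: inv w)
qed

text \<open>The block diagonal matrix \<open>kronecker (mat 1) P\<close> does not mix snapshots, so
  a claim about the stack reduces to vectors indexed by \<open>'n\<close>.\<close>

lemma kronecker_mat_1_mult:
  "(kronecker (mat 1) P ** M) $ (t, n) $ p = (P *v (\<chi> n'. M $ (t, n') $ p)) $ n"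
proof -
  have "(kronecker (mat 1) P ** M) $ (t, n) $ p =
      (\<Sum>t'\<in>UNIV. \<Sum>n'\<in>UNIV. (if t = t' then 1 else 0) * P $ n $ n' * M $ (t', n') $ p)"
    by (simp add: matrix_matrix_mult_def kronecker_def mat_def sum.cartesian_product'
        flip: UNIV_Times_UNIV)
  also have "\<dots> = (\<Sum>t'\<in>UNIV. if t = t' then \<Sum>n'\<in>UNIV. P $ n $ n' * M $ (t', n') $ p else 0)"
    by (rule sum.cong) simp_all
  finally show ?thesis by (simp add: matrix_vector_mult_def)
qed

lemma jac_dig_column_in_steering_span:
  assumes "\<And>x. (a has_vector_derivative a' x) (at x)"
  shows "(\<chi> n. jac_dig a s (param_vec \<theta> \<beta>) $ (t, n) $ p) \<in> steering_span a a' \<theta>"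
proof -
  have "(\<chi> n. jac_dig a s (param_vec \<theta> \<beta>) $ (t, n) $ p) =
      (case p of
        Inl k \<Rightarrow> (s $ t * \<beta> $ k) *s a' (\<theta> $ k)
      | Inr (k, im) \<Rightarrow> ((if im then \<i> else 1) * s $ t) *s a (\<theta> $ k))"
    by (simp add: jac_dig_def vec_eq_iff partial_deriv_mean_obs[OF assms]
        split: sum.split)
  then show ?thesis
    unfolding steering_span_def
    by (auto intro!: vec.span_scale[OF vec.span_base] split: sum.split)
qed

theorem corollary1:
  fixes a a' :: "real \<Rightarrow> complex ^ 'n"
    and \<theta> :: "real ^ 'k"
    and \<beta> :: "complex ^ 'k"
    and s :: "complex ^ 't"
    and sigma_sq :: real
    and G :: "complex ^ 'n ^ 'l"
  assumes a_deriv: "\<And>x. (a has_vector_derivative a' x) (at x)"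
    and angles_distinct: "inj (\<lambda>k. \<theta> $ k)"
    and amplitudes_nonzero: "\<And>k. \<beta> $ k \<noteq> 0"
    and waveform_nonzero: "s \<noteq> 0"
    and variance_pos: "sigma_sq > 0"
    and "2 * CARD('k) \<le> CARD('n)"
    and steering_dim: "vec.dim (steering_span a a' \<theta>) = 2 * CARD('k)"
    and "2 * CARD('k) \<le> CARD('l)"
    and "CARD('l) \<le> CARD('n)"
    and G_full_row_rank: "rank G = CARD('l)"
    and G_feasible: "G \<in> feasible_milac"
    and G_row_space: "steering_span a a' \<theta> \<subseteq> row_space G"
  shows "fim_milac a s sigma_sq (param_vec \<theta> \<beta>) G = fim_dig a s sigma_sq (param_vec \<theta> \<beta>) \<and>
    crb (fim_milac a s sigma_sq (param_vec \<theta> \<beta>) G) = crb (fim_dig a s sigma_sq (param_vec \<theta> \<beta>))"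
proof -
  let ?J = "jac_dig a s (param_vec \<theta> \<beta>)"
  let ?P = "conj_transpose G ** matrix_inv (G ** conj_transpose G) ** G"
  have "kronecker (mat 1) ?P ** ?J = ?J"
  proof -
    have "?P *v (\<chi> n. ?J $ (t, n) $ p) = (\<chi> n. ?J $ (t, n) $ p)" for t p
      using G_row_space jac_dig_column_in_steering_span[OF a_deriv]
      by (intro row_space_projector[OF G_full_row_rank]) blast
    then show ?thesis by (simp add: vec_eq_iff kronecker_mat_1_mult split_paired_all)
  qed
  \<comment> \<open>Bracketed to the right, the product under \<open>Re\<close> ends in
    \<open>kronecker (mat 1) ?P ** ?J\<close>, which collapses to \<open>?J\<close>.\<close>
  then have "fim_milac a s sigma_sq (param_vec \<theta> \<beta>) G = fim_dig a s sigma_sq (param_vec \<theta> \<beta>)"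
    unfolding fim_milac_def fim_dig_def by (simp only: matrix_mul_assoc[symmetric])
  \<comment> \<open>\<open>crb\<close> depends on the information matrix alone, so the bounds agree
    as well.\<close>
  then show ?thesis by simp
qed

end
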